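(* Let $P:\subseteq\mathbb{N}^{\mathbb{N}}\rightrightarrows\mathbb{N}^{\mathbb{N}}$ be an undiagonalizable problem and suppose that every instance of $P$ has a solution. Then Player 2 has a winning strategy in the infinite discontinuity game for $P$.
   Context: $\mathbb{N}^{\mathbb{N}}$ is Baire space; $\sigma\sqsubseteq x$ means the finite string $\sigma\in\mathbb{N}^{<\mathbb{N}}$ is an initial segment of $x$, and $[\![\sigma]\!]=\{x\in\mathbb{N}^{\mathbb{N}}:\sigma\sqsubseteq x\}$. A problem $P:\subseteq\mathbb{N}^{\mathbb{N}}\rightrightarrows\mathbb{N}^{\mathbb{N}}$ is a partial multivalued function: a set $\mathrm{dom}(P)$ of instances and, for each $p\in\mathrm{dom}(P)$, a set $P(p)\subseteq\mathbb{N}^{\mathbb{N}}$ of solutions. $P|[A\times B]$ has domain $\mathrm{dom}(P)\cap A$ and $P|[A\times B](x)=P(x)\cap B$ (possibly empty). **Undiagonalizable.** $P$ is undiagonalizable if there is a computable procedure (a Turing functional with oracle $p$) which, for all $\rho\in\mathbb{N}^{<\mathbb{N}}$ and $p\in\mathrm{dom}(P)$, decides whether $P(p)\cap[\![\rho]\!]=\emptyset$. **Infinite discontinuity game for $P$.** Rounds are played as follows, starting with the current problem $P$. In a round with current problem $R$: Player 1 plays $p\in\mathrm{dom}(R)$; if $R(p)=\emptyset$, Player 1 wins and the game ends; otherwise Player 2 plays $q\in R(p)$; Player 1 plays a finite $\rho\sqsubseteq q$; Player 2 plays a finite $\sigma\sqsubseteq p$; the next round is then played with current problem $R|[[\![\sigma]\!]\times[\![\rho]\!]]$.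 Player 2 wins a run if it is infinitely long. *)

theory Defs
  imports Main "HOL-Library.Nat_Bijection"
begin

type_synonym baire = "nat \<Rightarrow> nat"

definition initial_segment :: "nat list \<Rightarrow> baire \<Rightarrow> bool" where
  "initial_segment \<sigma> x \<longleftrightarrow> \<sigma> = map x [0..<length \<sigma>]"

definition cylinder :: "nat list \<Rightarrow> baire set" where
  "cylinder \<sigma> = {x. initial_segment \<sigma> x}"

(* A partial multivalued function on Baire space.  Some {} is an instance without
   solutions, None is a point outside of the domain; the domain is Map.dom. *)
type_synonym problem = "baire \<Rightarrow> baire set option"

definition solutions :: "problem \<Rightarrow> baire \<Rightarrow> baire set" where
  "solutions P p = the (P p)"

definition restrict_problem :: "problem \<Rightarrow> baire set \<Rightarrow> baire set \<Rightarrow> problem" where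
  "restrict_problem P A B = (\<lambda>x. if x \<in> A then map_option (\<lambda>S. S \<inter> B) (P x) else None)"

lemma dom_restrict_problem: "dom (restrict_problem P A B) = dom P \<inter> A"
  by (auto simp: restrict_problem_def split: if_splits)

lemma solutions_restrict_problem:
  "x \<in> dom P \<inter> A \<Longrightarrow> solutions (restrict_problem P A B) x = solutions P x \<inter> B"
  by (auto simp: restrict_problem_def solutions_def)


(* Turing functionals, presented as programs for the functions that are partial
   recursive in an oracle.  A program applied to an argument list of the wrong
   length may have no value. *)
datatype program =
    Zero_Fn
  | Succ_Fn
  | Proj_Fn nat
  | Oracle_Fn
  | Comp_Fn program "program list"
  | Rec_Fn program program
  | Min_Fn program

(* computes p e xs y: with oracle p, program e halts on input xs with output y. *)
inductive computes :: "baire \<Rightarrow> program \<Rightarrow> nat list \<Rightarrow> nat \<Rightarrow> bool" for p :: baire where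
  zero: "computes p Zero_Fn xs 0"
| succ: "computes p Succ_Fn [x] (Suc x)"
| proj: "i < length xs \<Longrightarrow> computes p (Proj_Fn i) xs (xs ! i)"
| oracle_query: "computes p Oracle_Fn [x] (p x)"
| comp: "\<lbrakk>length ys = length gs; \<forall>i<length gs. computes p (gs ! i) xs (ys ! i);
          computes p f ys z\<rbrakk> \<Longrightarrow> computes p (Comp_Fn f gs) xs z"
| rec_0: "computes p f xs y \<Longrightarrow> computes p (Rec_Fn f g) (0 # xs) y"
| rec_Suc: "\<lbrakk>computes p (Rec_Fn f g) (n # xs) y; computes p g (n # y # xs) z\<rbrakk>
          \<Longrightarrow> computes p (Rec_Fn f g) (Suc n # xs) z"
| min: "\<lbrakk>computes p f (n # xs) 0; \<forall>m<n. \<exists>k. computes p f (m # xs) (Suc k)\<rbrakk>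
          \<Longrightarrow> computes p (Min_Fn f) xs n"

inductive_cases computes_zeroE: "computes p Zero_Fn xs y"
inductive_cases computes_succE: "computes p Succ_Fn xs y"
inductive_cases computes_projE: "computes p (Proj_Fn i) xs y"
inductive_cases computes_oracleE: "computes p Oracle_Fn xs y"
inductive_cases computes_compE: "computes p (Comp_Fn f gs) xs y"
inductive_cases computes_rec_0E: "computes p (Rec_Fn f g) (0 # xs) y"
inductive_cases computes_rec_SucE: "computes p (Rec_Fn f g) (Suc n # xs) y"
inductive_cases computes_minE: "computes p (Min_Fn f) xs y"

lemma computes_deterministic:
  "computes p e xs y \<Longrightarrow> computes p e xs z \<Longrightarrow> y = z"
proof (induction arbitrary: z rule: computes.induct)
  case (comp ys gs xs f z z')
  from comp.prems obtain ys' where ys': "length ys' = length gs"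
      "\<forall>i<length gs. computes p (gs ! i) xs (ys' ! i)" "computes p f ys' z'"
    by (rule computes_compE) blast
  have "ys = ys'" using comp.hyps comp.IH(1) ys' by (intro nth_equalityI) auto
  then show ?case using comp.IH(2) ys'(3) by simp
next
  case (rec_0 f xs y g)
  from rec_0.prems show ?case by (rule computes_rec_0E) (rule rec_0.IH)
next
  case (rec_Suc f g n xs y z z')
  from rec_Suc.prems obtain y' where "computes p (Rec_Fn f g) (n # xs) y'"
      "computes p g (n # y' # xs) z'"
    by (rule computes_rec_SucE)
  then show ?case using rec_Suc.IH by blast
next
  case (min f n xs z)
  from min.prems have z: "computes p f (z # xs) 0"
      "\<forall>m<z. \<exists>k. computes p f (m # xs) (Suc k)"
    by (rule computes_minE, blast)+
  have "\<not> z < n" using min.IH(2) z(1) by blast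
  moreover have "\<not> n < z" using min.IH(1) z(2) by blast
  ultimately show ?case by simp
qed (blast elim: computes_zeroE computes_succE computes_projE computes_oracleE)+

(* A single program must work for all \<rho> and all p; strings are coded as numbers by the
   library's effective bijection, and the answer 1 means "empty". *)
definition undiagonalizable :: "problem \<Rightarrow> bool" where
  "undiagonalizable P \<longleftrightarrow>
     (\<exists>e. \<forall>\<rho>. \<forall>p\<in>dom P.
        computes p e [list_encode \<rho>] (if solutions P p \<inter> cylinder \<rho> = {} then 1 else 0))"


(* The four moves of a completed round, in the order in which they are played. *)
datatype game_round =
  Round (p1_instance: baire) (p2_solution: baire) (p1_string: "nat list") (p2_string: "nat list")

(* The problem with which the next round is played, the list of completed rounds
   being in chronological order. *)
fun current_problem :: "problem \<Rightarrow> game_round list \<Rightarrow> problem" where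
  "current_problem P [] = P"
| "current_problem P (Round p q \<rho> \<sigma> # rs) =
     current_problem (restrict_problem P (cylinder \<sigma>) (cylinder \<rho>)) rs"

fun legal_round :: "problem \<Rightarrow> game_round \<Rightarrow> bool" where
  "legal_round R (Round p q \<rho> \<sigma>) \<longleftrightarrow>
     p \<in> dom R \<and> q \<in> solutions R p \<and> initial_segment \<rho> q \<and> initial_segment \<sigma> p"

definition legal_history :: "problem \<Rightarrow> game_round list \<Rightarrow> bool" where
  "legal_history P rs \<longleftrightarrow>
     (\<forall>n<length rs. legal_round (current_problem P (take n rs)) (rs ! n))"

(* Finite_Run rs p ends because, after the completed rounds rs, Player 1 plays an
   instance p without solutions.  This is the only way in which a run ends.  A player
   who is to move but has no legal move has lost; only Player 1 can be in that position,
   and only at the very start, when dom P is empty (there is then no run at all). *)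
datatype game_run = Finite_Run "game_round list" baire | Infinite_Run "nat \<Rightarrow> game_round"

fun is_run :: "problem \<Rightarrow> game_run \<Rightarrow> bool" where
  "is_run P (Finite_Run rs p) \<longleftrightarrow>
     legal_history P rs \<and> p \<in> dom (current_problem P rs) \<and>
     solutions (current_problem P rs) p = {}"
| "is_run P (Infinite_Run r) \<longleftrightarrow>
     (\<forall>n. legal_round (current_problem P (map r [0..<n])) (r n))"

fun player2_wins :: "game_run \<Rightarrow> bool" where
  "player2_wins (Finite_Run rs p) \<longleftrightarrow> False"
| "player2_wins (Infinite_Run r) \<longleftrightarrow> True"

(* A strategy of Player 2 answers every position, given by the completed rounds followed
   by the moves of the current round: p for the first component, p, q, \<rho> for the second. *)
type_synonym strategy2 =
  "(game_round list \<Rightarrow> baire \<Rightarrow> baire) \<times>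
   (game_round list \<Rightarrow> baire \<Rightarrow> baire \<Rightarrow> nat list \<Rightarrow> nat list)"

(* Whenever it is Player 2's turn, the prescribed move is legal. *)
definition legal_strategy :: "problem \<Rightarrow> strategy2 \<Rightarrow> bool" where
  "legal_strategy P \<tau> \<longleftrightarrow>
     (\<forall>rs. legal_history P rs \<longrightarrow>
       (\<forall>p \<in> dom (current_problem P rs). solutions (current_problem P rs) p \<noteq> {} \<longrightarrow>
          fst \<tau> rs p \<in> solutions (current_problem P rs) p \<and>
          (\<forall>q \<in> solutions (current_problem P rs) p. \<forall>\<rho>. initial_segment \<rho> q \<longrightarrow>
             initial_segment (snd \<tau> rs p q \<rho>) p)))"

fun follows_round :: "strategy2 \<Rightarrow> game_round list \<Rightarrow> game_round \<Rightarrow> bool" where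
  "follows_round \<tau> rs (Round p q \<rho> \<sigma>) \<longleftrightarrow> q = fst \<tau> rs p \<and> \<sigma> = snd \<tau> rs p q \<rho>"

fun follows :: "strategy2 \<Rightarrow> game_run \<Rightarrow> bool" where
  "follows \<tau> (Finite_Run rs p) \<longleftrightarrow> (\<forall>n<length rs. follows_round \<tau> (take n rs) (rs ! n))"
| "follows \<tau> (Infinite_Run r) \<longleftrightarrow> (\<forall>n. follows_round \<tau> (map r [0..<n]) (r n))"

definition winning_strategy2 :: "problem \<Rightarrow> strategy2 \<Rightarrow> bool" where
  "winning_strategy2 P \<tau> \<longleftrightarrow>
     legal_strategy P \<tau> \<and> (\<forall>run. is_run P run \<and> follows \<tau> run \<longrightarrow> player2_wins run)"

end

theory Submission imports Defs begin

text \<open>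
  A computation that halts has queried its oracle at finitely many places only
  (\<open>computes_use\<close>).  So if a Turing functional decides whether \<open>P(p)\<close> meets a cylinder, then a
  positive answer at \<open>p\<close> is already forced by a finite initial segment \<open>\<sigma>\<close> of \<open>p\<close>: every instance
  that extends \<open>\<sigma>\<close> also has a solution in that cylinder.  This continuity property
  is called \<open>locally_solvable\<close> below.

  Player 2 uses it as follows.  The invariant is that every instance of the current problem has a
  solution.  Player 2 answers an instance \<open>p\<close> by any solution \<open>q\<close>.  When Player 1 commits the
  solutions to \<open>\<rho> \<sqsubseteq> q\<close>, the instance \<open>p\<close> still has the solution \<open>q\<close>, and so there is a
  \<open>\<sigma> \<sqsubseteq> p\<close> that forces a solution extending \<open>\<rho>\<close>.  Player 2 plays such a \<open>\<sigma>\<close>, and the restricted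
  problem has no instance without solutions.  Hence the run never ends.

  To repeat this in every round, the restricted problem has to be locally solvable again.  It is,
  because two cylinders are nested or disjoint: demanding a solution in \<open>[\<rho>] \<inter> [\<rho>']\<close> is
  demanding one in a single cylinder, or is impossible (\<open>locally_solvable_restrict\<close>).
\<close>

lemma initial_segment_iff: "initial_segment \<sigma> x \<longleftrightarrow> (\<forall>i<length \<sigma>. x i = \<sigma> ! i)"
  unfolding initial_segment_def list_eq_iff_nth_eq by auto

lemma initial_segment_map_upt: "initial_segment (map p [0..<n]) x \<longleftrightarrow> (\<forall>i<n. x i = p i)"
  by (auto simp: initial_segment_iff)

lemma mem_cylinder: "x \<in> cylinder \<sigma> \<longleftrightarrow> initial_segment \<sigma> x"
  by (simp add: cylinder_def)

lemma cylinder_inter: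
  "cylinder \<rho> \<inter> cylinder \<rho>' = {} \<or> (\<exists>\<tau>. cylinder \<rho> \<inter> cylinder \<rho>' = cylinder \<tau>)"
proof (cases "cylinder \<rho> \<inter> cylinder \<rho>' = {}")
  case False
  then obtain z where z: "initial_segment \<rho> z" "initial_segment \<rho>' z"
    by (auto simp: mem_cylinder)
  \<comment> \<open>The longer of the two strings, read off from a common extension.\<close>
  have "cylinder \<rho> \<inter> cylinder \<rho>' = cylinder (map z [0..<max (length \<rho>) (length \<rho>')])"
    using z by (auto simp: mem_cylinder initial_segment_map_upt)
      (auto simp: initial_segment_iff less_max_iff_disj)
  then show ?thesis by blast
qed simp

lemma uniform_bound:
  fixes Q :: "nat \<Rightarrow> nat \<Rightarrow> bool"
  assumes "\<forall>i<k. \<exists>n. Q i n"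
  shows "\<exists>N. \<forall>i<k. \<exists>n\<le>N. Q i n"
proof -
  from assms obtain f where "\<forall>i<k. Q i (f i)" by metis
  then have "\<forall>i<k. f i \<le> Max (f ` {..<k}) \<and> Q i (f i)" by auto
  then show ?thesis by blast
qed

text \<open>
  The use principle: a derivation of a halting computation is well-founded and each of its rules
  has finitely many premises (an unbounded search with value \<open>n\<close> makes the tests \<open>0, \<dots>, n\<close>), so
  the oracle queries in it have a common bound.
\<close>

lemma computes_use:
  assumes "computes p e xs y"
  shows "\<exists>n. \<forall>p'. (\<forall>i<n. p' i = p i) \<longrightarrow> computes p' e xs y"
  using assms
proof (induction rule: computes.induct)
  case (oracle_query x)
  have "computes p' Oracle_Fn [x] (p x)" if "\<forall>i<Suc x. p' i = p i" for p'
    using that computes.oracle_query[of p' x] by simp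
  then show ?case by blast
next
  case (comp ys gs xs f z)
  let ?use = "\<lambda>i n. \<forall>p'. (\<forall>j<n. p' j = p j) \<longrightarrow> computes p' (gs ! i) xs (ys ! i)"
  have "\<forall>i<length gs. \<exists>n. ?use i n" using comp.IH(1) by simp
  from uniform_bound[OF this] obtain N where N: "\<forall>i<length gs. \<exists>n\<le>N. ?use i n" ..
  obtain M where M: "\<And>p'. (\<forall>i<M. p' i = p i) \<Longrightarrow> computes p' f ys z"
    using comp.IH(2) by blast
  have "computes p' (Comp_Fn f gs) xs z" if p': "\<forall>i<max N M. p' i = p i" for p'
  proof (rule computes.comp[OF comp.hyps(1)])
    show "\<forall>i<length gs. computes p' (gs ! i) xs (ys ! i)"
      using N p' by (meson less_le_trans max.cobounded1)
    show "computes p' f ys z" using M p' by simp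
  qed
  then show ?case by blast
next
  case (rec_0 f xs y g)
  then show ?case by (meson computes.rec_0)
next
  case (rec_Suc f g n xs y z)
  obtain N where N: "\<And>p'. (\<forall>i<N. p' i = p i) \<Longrightarrow> computes p' (Rec_Fn f g) (n # xs) y"
    using rec_Suc.IH(1) by blast
  obtain M where M: "\<And>p'. (\<forall>i<M. p' i = p i) \<Longrightarrow> computes p' g (n # y # xs) z"
    using rec_Suc.IH(2) by blast
  have "computes p' (Rec_Fn f g) (Suc n # xs) z" if "\<forall>i<max N M. p' i = p i" for p'
    using that by (intro computes.rec_Suc[OF N M]) auto
  then show ?case by blast
next
  case (min f n xs)
  let ?use = "\<lambda>m N. \<exists>k. \<forall>p'. (\<forall>i<N. p' i = p i) \<longrightarrow> computes p' f (m # xs) (Suc k)"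
  have "\<forall>m<n. \<exists>N. ?use m N" using min.IH(2) by meson
  from uniform_bound[OF this] obtain N where N: "\<forall>m<n. \<exists>N'\<le>N. ?use m N'" ..
  obtain M where M: "\<And>p'. (\<forall>i<M. p' i = p i) \<Longrightarrow> computes p' f (n # xs) 0"
    using min.IH(1) by blast
  have "computes p' (Min_Fn f) xs n" if p': "\<forall>i<max N M. p' i = p i" for p'
  proof (rule computes.min)
    show "computes p' f (n # xs) 0" using M p' by simp
    show "\<forall>m<n. \<exists>k. computes p' f (m # xs) (Suc k)"
      using N p' by (meson less_le_trans max.cobounded1)
  qed
  then show ?case by blast
qed (blast intro: computes.intros)+

text \<open>
  Lower hemicontinuity of \<open>R\<close>: for each basic open set of solutions, the instances with a solution
  in it form a relatively open subset of the domain.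
\<close>

definition locally_solvable :: "problem \<Rightarrow> bool" where
  "locally_solvable R \<longleftrightarrow>
     (\<forall>\<rho>. \<forall>p\<in>dom R. solutions R p \<inter> cylinder \<rho> \<noteq> {} \<longrightarrow>
        (\<exists>\<sigma>. initial_segment \<sigma> p \<and>
           (\<forall>p'\<in>dom R \<inter> cylinder \<sigma>. solutions R p' \<inter> cylinder \<rho> \<noteq> {})))"

text \<open>
  An oracle that agrees with \<open>p\<close> on the use of the computation receives the same answer as \<open>p\<close>.
\<close>

lemma undiagonalizable_imp_locally_solvable:
  assumes "undiagonalizable P"
  shows "locally_solvable P"
  unfolding locally_solvable_def
proof (intro allI ballI impI)
  fix \<rho> p
  assume p: "p \<in> dom P" and ne: "solutions P p \<inter> cylinder \<rho> \<noteq> {}"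
  from assms obtain e where e: "\<And>\<rho> p. p \<in> dom P \<Longrightarrow>
      computes p e [list_encode \<rho>] (if solutions P p \<inter> cylinder \<rho> = {} then 1 else 0)"
    unfolding undiagonalizable_def by blast
  have "computes p e [list_encode \<rho>] 0" using e[OF p, of \<rho>] ne by simp
  then obtain n where n: "\<And>p'. (\<forall>i<n. p' i = p i) \<Longrightarrow> computes p' e [list_encode \<rho>] 0"
    using computes_use by blast
  have "solutions P p' \<inter> cylinder \<rho> \<noteq> {}"
    if p': "p' \<in> dom P \<inter> cylinder (map p [0..<n])" for p'
  proof -
    have "computes p' e [list_encode \<rho>] 0"
      using p' by (intro n) (simp add: mem_cylinder initial_segment_map_upt)
    then show ?thesis
      using computes_deterministic e[of p' \<rho>] p' by (fastforce split: if_splits)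
  qed
  moreover have "initial_segment (map p [0..<n]) p"
    by (simp add: initial_segment_map_upt)
  ultimately show "\<exists>\<sigma>. initial_segment \<sigma> p \<and>
      (\<forall>p'\<in>dom P \<inter> cylinder \<sigma>. solutions P p' \<inter> cylinder \<rho> \<noteq> {})"
    by blast
qed

lemma locally_solvable_restrict:
  assumes "locally_solvable R"
  shows "locally_solvable (restrict_problem R A (cylinder \<rho>))"
  unfolding locally_solvable_def dom_restrict_problem
proof (intro allI ballI impI)
  fix \<rho>' p
  assume p: "p \<in> dom R \<inter> A"
    and "solutions (restrict_problem R A (cylinder \<rho>)) p \<inter> cylinder \<rho>' \<noteq> {}"
  then have ne: "solutions R p \<inter> (cylinder \<rho> \<inter> cylinder \<rho>') \<noteq> {}"
    by (simp add: solutions_restrict_problem Int_assoc)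
  then obtain \<tau> where \<tau>: "cylinder \<rho> \<inter> cylinder \<rho>' = cylinder \<tau>"
    using cylinder_inter[of \<rho> \<rho>'] by blast
  obtain \<sigma> where "initial_segment \<sigma> p"
      "\<forall>p'\<in>dom R \<inter> cylinder \<sigma>. solutions R p' \<inter> cylinder \<tau> \<noteq> {}"
    using assms p ne unfolding locally_solvable_def \<tau> by blast
  then show "\<exists>\<sigma>. initial_segment \<sigma> p \<and>
      (\<forall>p'\<in>dom R \<inter> A \<inter> cylinder \<sigma>.
         solutions (restrict_problem R A (cylinder \<rho>)) p' \<inter> cylinder \<rho>' \<noteq> {})"
    by (auto simp: solutions_restrict_problem Int_assoc \<tau>)
qed

lemma current_problem_snoc:
  "current_problem P (rs @ [Round p q \<rho> \<sigma>]) =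
     restrict_problem (current_problem P rs) (cylinder \<sigma>) (cylinder \<rho>)"
  by (induction P rs rule: current_problem.induct) auto

lemma locally_solvable_current_problem:
  "locally_solvable P \<Longrightarrow> locally_solvable (current_problem P rs)"
  by (induction P rs rule: current_problem.induct) (simp_all add: locally_solvable_restrict)

definition all_solvable :: "problem \<Rightarrow> bool" where
  "all_solvable R \<longleftrightarrow> (\<forall>p\<in>dom R. solutions R p \<noteq> {})"

definition any_solution :: "problem \<Rightarrow> baire \<Rightarrow> baire" where
  "any_solution R p = (SOME q. q \<in> solutions R p)"

definition forcing_string :: "problem \<Rightarrow> baire \<Rightarrow> nat list \<Rightarrow> nat list" where
  "forcing_string R p \<rho> =
     (SOME \<sigma>. initial_segment \<sigma> p \<and>
        all_solvable (restrict_problem R (cylinder \<sigma>) (cylinder \<rho>)))"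

definition forcing_strategy :: "problem \<Rightarrow> strategy2" where
  "forcing_strategy P =
     (\<lambda>rs. any_solution (current_problem P rs),
      \<lambda>rs p q. forcing_string (current_problem P rs) p)"

lemma forcing_string:
  assumes "locally_solvable R" "p \<in> dom R" "q \<in> solutions R p" "initial_segment \<rho> q"
  shows "initial_segment (forcing_string R p \<rho>) p"
    and "all_solvable (restrict_problem R (cylinder (forcing_string R p \<rho>)) (cylinder \<rho>))"
proof -
  have "solutions R p \<inter> cylinder \<rho> \<noteq> {}" using assms(3,4) by (auto simp: mem_cylinder)
  then obtain \<sigma> where "initial_segment \<sigma> p"
      "\<forall>p'\<in>dom R \<inter> cylinder \<sigma>. solutions R p' \<inter> cylinder \<rho> \<noteq> {}"
    using assms(1,2) unfolding locally_solvable_def by blast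
  then have "\<exists>\<sigma>. initial_segment \<sigma> p \<and>
      all_solvable (restrict_problem R (cylinder \<sigma>) (cylinder \<rho>))"
    by (auto simp: all_solvable_def dom_restrict_problem solutions_restrict_problem)
  from someI_ex[OF this]
  show "initial_segment (forcing_string R p \<rho>) p"
    and "all_solvable (restrict_problem R (cylinder (forcing_string R p \<rho>)) (cylinder \<rho>))"
    unfolding forcing_string_def by blast+
qed

text \<open>
  Legality is demanded in every legal position, also in those that the strategy itself avoids and
  where some instances have lost all their solutions.  This is why local solvability is tracked
  separately from the invariant that all instances are solvable.
\<close>

lemma legal_forcing_strategy:
  assumes "locally_solvable P"
  shows "legal_strategy P (forcing_strategy P)"
  unfolding legal_strategy_def forcing_strategy_def any_solution_def
  using forcing_string(1)[OF locally_solvable_current_problem[OF assms]]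
  by (auto simp: some_in_eq)

lemma all_solvable_current_problem:
  assumes "locally_solvable P" "all_solvable P"
    and "legal_history P rs"
    and "\<forall>n<length rs. follows_round (forcing_strategy P) (take n rs) (rs ! n)"
  shows "all_solvable (current_problem P rs)"
proof (cases rs rule: rev_cases)
  case Nil
  then show ?thesis using assms(2) by simp
next
  \<comment> \<open>The string forced in the last round leaves no instance without solutions.\<close>
  case (snoc rs' r)
  obtain p q \<rho> \<sigma> where r: "r = Round p q \<rho> \<sigma>" by (cases r)
  let ?R = "current_problem P rs'"
  have "legal_round ?R r"
    using assms(3) unfolding legal_history_def snoc
    by (auto dest!: spec[of _ "length rs'"])
  then have "p \<in> dom ?R" "q \<in> solutions ?R p" "initial_segment \<rho> q"
    by (simp_all only: r legal_round.simps)
  moreover have "\<sigma> = forcing_string ?R p \<rho>"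
    using assms(4) unfolding snoc r
    by (auto simp: forcing_strategy_def dest!: spec[of _ "length rs'"])
  ultimately show ?thesis
    using forcing_string(2)[OF locally_solvable_current_problem[OF assms(1)]]
    by (simp add: snoc r current_problem_snoc del: domIff)
qed

theorem theorem4p2p11:
  fixes P :: problem
  assumes "undiagonalizable P"
    and "\<And>p. p \<in> dom P \<Longrightarrow> solutions P p \<noteq> {}"
  shows "\<exists>\<tau>. winning_strategy2 P \<tau>"
proof -
  have local: "locally_solvable P"
    using assms(1) by (rule undiagonalizable_imp_locally_solvable)
  have total: "all_solvable P" using assms(2) by (simp add: all_solvable_def)
  have "player2_wins run" if "is_run P run" "follows (forcing_strategy P) run" for run
  proof (cases run)
    case (Finite_Run rs p)
    then have "all_solvable (current_problem P rs)"
      using that by (intro all_solvable_current_problem[OF local total]) auto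
    then show ?thesis using that Finite_Run by (auto simp: all_solvable_def)
  qed simp
  then show ?thesis
    using legal_forcing_strategy[OF local] unfolding winning_strategy2_def by blast
qed

end
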